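(* Let $$F(t,z)=\sum_{n,k\ge 1}\bigl|\{\pi\in \mathcal{S}_n(321,4123) : \operatorname{cyc}(\pi)=k\}\bigr|\,t^kz^n,$$ a formal power series in $z$ with coefficients in $\mathbb{Z}[t]$. Then $$F(t,z)=\frac{tz(1-z^2)}{1-z(1+t)-2z^2+z^3}.$$
   Context: $\mathcal{S}_n$ is the set of permutations of $[n]=\{1,\dots,n\}$; $\pi\in\mathcal{S}_n$ is written in one-line notation as $\pi=\pi_1\pi_2\cdots\pi_n$ with $\pi_i=\pi(i)$. A permutation $\pi\in\mathcal{S}_n$ contains a pattern $\sigma\in\mathcal{S}_r$ if there are indices $i_1<\dots<i_r$ such that $\pi_{i_1}\cdots\pi_{i_r}$ is in the same relative order as $\sigma$; otherwise $\pi$ avoids $\sigma$. $\mathcal{S}_n(321,4123)$ is the set of $\pi\in\mathcal{S}_n$ avoiding both patterns $321$ and $4123$. $\operatorname{cyc}(\pi)$ is the number of cycles in the disjoint cycle decomposition of $\pi$, fixed points counted as cycles. *)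

theory Defs
  imports
    "HOL-Combinatorics.Combinatorics"
    "HOL-Computational_Algebra.Computational_Algebra"
begin

text \<open>A pattern of length \<open>r\<close> is given by its one-line notation, a list of length \<open>r\<close>.\<close>

definition same_relative_order :: "nat list \<Rightarrow> nat list \<Rightarrow> bool" where
  "same_relative_order xs ys \<longleftrightarrow> length xs = length ys \<and>
     (\<forall>a < length xs. \<forall>b < length xs. xs ! a < xs ! b \<longleftrightarrow> ys ! a < ys ! b)"

definition contains_pattern :: "nat \<Rightarrow> (nat \<Rightarrow> nat) \<Rightarrow> nat list \<Rightarrow> bool" where
  "contains_pattern n \<pi> \<sigma> \<longleftrightarrow>
     (\<exists>is. sorted_wrt (<) is \<and> set is \<subseteq> {1..n} \<and> same_relative_order (map \<pi> is) \<sigma>)"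

definition avoiders :: "nat \<Rightarrow> nat list set \<Rightarrow> (nat \<Rightarrow> nat) set" where
  "avoiders n \<Sigma> = {\<pi>. \<pi> permutes {1..n} \<and> (\<forall>\<sigma>\<in>\<Sigma>. \<not> contains_pattern n \<pi> \<sigma>)}"

text \<open>The cycles of a permutation, as sets, are its orbits; a fixed point \<open>x\<close> has orbit \<open>{x}\<close>.\<close>

definition cyc :: "nat \<Rightarrow> (nat \<Rightarrow> nat) \<Rightarrow> nat" where
  "cyc n \<pi> = card (orbit \<pi> ` {1..n})"

lemma cyc_le: "cyc n \<pi> \<le> n"
  unfolding cyc_def using card_image_le[of "{1..n}" "orbit \<pi>"] by simp

text \<open>
  Elements of \<open>\<int>[t][[z]]\<close> are of type \<^typ>\<open>int poly fps\<close>. By \<open>cyc_le\<close>, the sum over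
  \<open>k \<ge> 1\<close> may be cut off at \<open>n\<close>; the coefficient for \<open>n = 0\<close> is an empty sum.
\<close>

definition cycle_gf :: "nat list set \<Rightarrow> int poly fps" where
  "cycle_gf \<Sigma> =
     Abs_fps (\<lambda>n. \<Sum>k = 1..n. monom (int (card {\<pi> \<in> avoiders n \<Sigma>. cyc n \<pi> = k})) k)"

text \<open>
  The library's division of power series needs an inverse operation on the coefficients, which
  \<^typ>\<open>int poly\<close> lacks. A series with constant coefficient \<open>1\<close> is nevertheless a unit, and
  this is the quotient by such a series.
\<close>

definition fps_quot :: "'a :: comm_ring_1 fps \<Rightarrow> 'a fps \<Rightarrow> 'a fps" where
  "fps_quot f g = f * fps_right_inverse g 1"

lemma fps_quot_mult:
  assumes "fps_nth g 0 = 1"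
  shows "fps_quot f g * g = f"
proof -
  have "g * fps_right_inverse g 1 = 1"
    using assms by (intro fps_right_inverse) simp
  then show ?thesis
    unfolding fps_quot_def by (metis mult.assoc mult.commute mult_1_right)
qed

end

theory Submission
  imports Defs
begin

text \<open>
  A permutation avoids 321 and 4123 iff no entry has three smaller entries to its right and the
  smaller entries to the right of each entry increase. So \<open>\<pi>\<close> starts with 1, with 2, with 3 1, or
  with 3 4. Contracting a point \<open>m\<close> that is not fixed, that is, passing from \<open>\<pi>\<close> to
  \<open>transpose m (\<pi> m) \<circ> \<pi>\<close>, preserves the number of cycles. Contracting the first point, and in the
  last two cases also the second, leaves the other entries in the same relative order and yields
  an arbitrary shorter permutation of the class, except that after 3 4 it must not start with 2,
  since otherwise 2 would precede 1 in \<open>\<pi>\<close>. Hence the cycle polynomials satisfy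
  \<open>a\<^sub>n = t a\<^sub>n\<^sub>-\<^sub>1 + a\<^sub>n\<^sub>-\<^sub>1 + a\<^sub>n\<^sub>-\<^sub>2 + (a\<^sub>n\<^sub>-\<^sub>2 - a\<^sub>n\<^sub>-\<^sub>3)\<close> for \<open>n \<ge> 4\<close>.
\<close>

section \<open>Contracting a point of a permutation\<close>

text \<open>The set is arbitrary, not \<open>{1..n}\<close>, because contraction removes points from
  it one at a time.\<close>

definition orbit_count :: "'a set \<Rightarrow> ('a \<Rightarrow> 'a) \<Rightarrow> nat" where
  "orbit_count S \<pi> = card (orbit \<pi> ` S)"

lemma orbit_eq_of_mem:
  assumes "finite S" "\<pi> permutes S" "y \<in> orbit \<pi> x"
  shows "orbit \<pi> y = orbit \<pi> x"
proof -
  have "cyclic_on \<pi> (orbit \<pi> x)"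
    using assms(2,1) by (rule cyclic_on_orbit)
  then show ?thesis
    using assms(3) by (rule orbit_cyclic_eq3)
qed

lemma self_mem_orbit:
  assumes "finite S" "\<pi> permutes S"
  shows "x \<in> orbit \<pi> x"
  using assms by (intro permutation_self_in_orbit permutes_imp_permutation)

text \<open>Composing with \<open>transpose m k\<close> inserts \<open>m\<close> into the cycle of
  \<open>k\<close>, immediately before \<open>k\<close>. The cyclic order of the points of
  \<open>S\<close> does not change.\<close>

lemma orbit_transpose_comp_iff:
  assumes "\<sigma> permutes S" "m \<notin> S" "k \<in> S" "x \<in> S" "y \<in> S"
  shows "y \<in> orbit (transpose m k \<circ> \<sigma>) x \<longleftrightarrow> y \<in> orbit \<sigma> x"
proof
  let ?\<pi> = "transpose m k \<circ> \<sigma>"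
  \<comment> \<open>\<open>?c\<close> replaces a visit to \<open>m\<close> by its successor
    \<open>k\<close>, so that it stays within an orbit of \<open>\<sigma>\<close>.\<close>
  let ?c = "\<lambda>y. if y = m then k else y"
  have m: "\<sigma> m = m"
    using assms(1,2) by (rule permutes_not_in)
  have c: "?c (?\<pi> z) = (if z = m then k else \<sigma> z)" if "z \<in> insert m S" for z
    using that m assms by (auto simp: transpose_def permutes_in_image)
  have "?c z \<in> orbit \<sigma> x \<and> z \<in> insert m S" if "z \<in> orbit ?\<pi> x" for z
    using that
  proof induction
    case base
    have "?\<pi> x \<in> insert m S"
      using assms by (auto simp: transpose_def permutes_in_image)
    moreover have "x \<noteq> m"
      using assms by auto
    ultimately show ?case
      using c[of x] assms(4) orbit.base[of \<sigma> x] by simp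
  next
    case (step z)
    then have "?\<pi> z \<in> insert m S"
      using assms m by (auto simp: transpose_def permutes_in_image)
    moreover have "?c (?\<pi> z) \<in> orbit \<sigma> x"
      using step c[of z] orbit.step[of z \<sigma> x] by (cases "z = m") auto
    ultimately show ?case
      by blast
  qed
  moreover assume "y \<in> orbit ?\<pi> x"
  ultimately show "y \<in> orbit \<sigma> x"
    using assms by (metis (full_types))
next
  let ?\<pi> = "transpose m k \<circ> \<sigma>"
  have \<pi>m: "?\<pi> m = k"
    using permutes_not_in[OF assms(1,2)] by simp
  \<comment> \<open>One step of \<open>\<sigma>\<close> is one step of \<open>?\<pi>\<close>, or two
    steps through \<open>m\<close> if it arrives at \<open>k\<close>.\<close>
  have jump: "\<sigma> z \<in> orbit ?\<pi> x" if "z \<in> S" "?\<pi> z \<in> orbit ?\<pi> x" for z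
  proof (cases "\<sigma> z = k")
    case True
    then show ?thesis
      using that \<pi>m orbit.step[of m ?\<pi> x] by simp
  next
    case False
    then have "?\<pi> z = \<sigma> z"
      using that assms by (auto simp: transpose_def permutes_in_image)
    then show ?thesis
      using that by simp
  qed
  have "z \<in> orbit ?\<pi> x \<and> z \<in> S" if "z \<in> orbit \<sigma> x" for z
    using that
  proof induction
    case base
    show ?case
      using jump[OF assms(4)] orbit.base[of ?\<pi> x] assms(1,4) by (simp add: permutes_in_image del: o_apply)
  next
    case (step z)
    then show ?case
      using jump[of z] orbit.step[of z ?\<pi> x] assms(1) by (simp add: permutes_in_image del: o_apply)
  qed
  moreover assume "y \<in> orbit \<sigma> x"
  ultimately show "y \<in> orbit ?\<pi> x"
    by blast
qed

text \<open>Intersecting with \<open>S\<close> maps the orbits of the composite bijectively to those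
  of \<open>\<sigma>\<close>: the orbit of \<open>m\<close> contains \<open>k\<close>, so every
  orbit meets \<open>S\<close>, and orbits that share a point are equal.\<close>

lemma orbit_count_transpose_comp:
  assumes "finite S" "\<sigma> permutes S" "m \<notin> S" "k \<in> S"
  shows "orbit_count (insert m S) (transpose m k \<circ> \<sigma>) = orbit_count S \<sigma>"
proof -
  let ?\<pi> = "transpose m k \<circ> \<sigma>"
  have fin: "finite (insert m S)"
    using assms(1) by simp
  have perm: "?\<pi> permutes insert m S"
    using assms by (intro permutes_compose permutes_swap_id permutes_imp_permutes_insert) auto
  have "?\<pi> m = k"
    using permutes_not_in[OF assms(2,3)] by simp
  then have "k \<in> orbit ?\<pi> m"
    using orbit.base[of ?\<pi> m] by simp
  then have "orbit ?\<pi> m = orbit ?\<pi> k"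
    using orbit_eq_of_mem[OF fin perm] by simp
  then have 1: "orbit ?\<pi> ` insert m S = orbit ?\<pi> ` S"
    using assms(4) by auto
  have inter: "orbit ?\<pi> x \<inter> S = orbit \<sigma> x" if "x \<in> S" for x
    using that orbit_transpose_comp_iff[OF assms(2-4)] permutes_orbit_subset[OF assms(2)] by blast
  have "orbit ?\<pi> x = orbit ?\<pi> y" if "x \<in> S" "orbit ?\<pi> x \<inter> S = orbit ?\<pi> y \<inter> S" for x y
    using that self_mem_orbit[OF fin perm] orbit_eq_of_mem[OF fin perm] by blast
  then have "inj_on (\<lambda>X. X \<inter> S) (orbit ?\<pi> ` S)"
    by (auto simp: inj_on_def)
  then have "card (orbit ?\<pi> ` S) = card ((\<lambda>X. X \<inter> S) ` orbit ?\<pi> ` S)"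
    by (simp add: card_image)
  also have "(\<lambda>X. X \<inter> S) ` orbit ?\<pi> ` S = orbit \<sigma> ` S"
    using inter by (force simp: image_image)
  finally show ?thesis
    unfolding orbit_count_def 1 .
qed

lemma orbit_count_insert_fixpoint:
  assumes "finite S" "\<sigma> permutes S" "m \<notin> S"
  shows "orbit_count (insert m S) \<sigma> = Suc (orbit_count S \<sigma>)"
proof -
  have "orbit \<sigma> m = {m}"
    using assms by (simp add: orbit_eq_singleton_iff permutes_not_in)
  moreover have "{m} \<notin> orbit \<sigma> ` S"
    using assms permutes_orbit_subset[OF assms(2)] by blast
  ultimately show ?thesis
    using assms(1) by (simp add: orbit_count_def)
qed

section \<open>Avoidance of 321 and 4123\<close>

text \<open>
  Here \<open>i\<close> is the position of the largest entry of a pattern. Positions range over all naturals: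
  points outside the support are fixed and cannot take part in an occurrence.
\<close>

definition avoids_at :: "(nat \<Rightarrow> nat) \<Rightarrow> nat \<Rightarrow> bool" where
  "avoids_at \<pi> i \<longleftrightarrow>
     \<not> (\<exists>j k. i < j \<and> j < k \<and> \<pi> k < \<pi> j \<and> \<pi> j < \<pi> i) \<and>
     \<not> (\<exists>j k l. i < j \<and> j < k \<and> k < l \<and> \<pi> j < \<pi> k \<and> \<pi> k < \<pi> l \<and> \<pi> l < \<pi> i)"

definition avoids_both :: "(nat \<Rightarrow> nat) \<Rightarrow> bool" where
  "avoids_both \<pi> \<longleftrightarrow> (\<forall>i. avoids_at \<pi> i)"

definition avoiding_perms :: "nat \<Rightarrow> nat \<Rightarrow> (nat \<Rightarrow> nat) set" where
  "avoiding_perms m b = {\<pi>. \<pi> permutes {m..<b} \<and> avoids_both \<pi>}"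

lemma finite_avoiding_perms: "finite (avoiding_perms m b)"
  unfolding avoiding_perms_def by (simp add: finite_permutations)

text \<open>A fixed point below the interval has only larger values to its right, and one above the
  interval only smaller values to its left. So neither can take that place in an inversion.\<close>

lemma permutes_descent_bounds:
  fixes \<pi> :: "nat \<Rightarrow> nat"
  assumes "\<pi> permutes {m..<b}" "i < j" "\<pi> j < \<pi> i"
  shows "m \<le> i" "j < b"
proof -
  have *: "\<And>x. \<pi> x \<in> {m..<b} \<longleftrightarrow> x \<in> {m..<b}" "\<And>x. x \<notin> {m..<b} \<Longrightarrow> \<pi> x = x"
    using permutes_in_image[OF assms(1)] permutes_not_in[OF assms(1)] by blast+
  show "m \<le> i"
    using *[of i] *[of j] assms(2,3) by (cases "j \<in> {m..<b}") auto
  show "j < b"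
    using *[of i] *[of j] assms(2,3) by (cases "i \<in> {m..<b}") auto
qed

lemma avoids_at_below:
  assumes "\<pi> permutes {m..<b}" "i < m"
  shows "avoids_at \<pi> i"
  using permutes_descent_bounds(1)[OF assms(1), of i] assms(2)
  unfolding avoids_at_def by (meson leD less_trans)

text \<open>Three smaller entries to the right of an entry contain a descent or are increasing.\<close>

lemma avoids_at_three_smaller:
  assumes "avoids_at \<pi> i" "inj \<pi>"
    and "i < p" "i < q" "i < r" "p \<noteq> q" "p \<noteq> r" "q \<noteq> r"
    and "\<pi> p < \<pi> i" "\<pi> q < \<pi> i" "\<pi> r < \<pi> i"
  shows False
proof -
  have sorted: False if "i < p" "p < q" "q < r" "\<pi> p < \<pi> i" "\<pi> q < \<pi> i" "\<pi> r < \<pi> i" for p q r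
  proof -
    have "\<pi> p \<noteq> \<pi> q" "\<pi> q \<noteq> \<pi> r"
      using that assms(2) by (auto simp: inj_eq)
    then have "\<pi> q < \<pi> p \<or> \<pi> r < \<pi> q \<or> \<pi> p < \<pi> q \<and> \<pi> q < \<pi> r"
      by linarith
    then show False
      using assms(1) that unfolding avoids_at_def by (meson less_trans)
  qed
  consider "p < q" "q < r" | "p < r" "r < q" | "q < p" "p < r" | "q < r" "r < p"
    | "r < p" "p < q" | "r < q" "q < p"
    using assms(6-8) by linarith
  then show False
  proof cases
    case 1
    show False
      by (rule sorted[OF assms(3) 1 assms(9,10,11)])
  next
    case 2
    show False
      by (rule sorted[OF assms(3) 2 assms(9,11,10)])
  next
    case 3
    show False
      by (rule sorted[OF assms(4) 3 assms(10,9,11)])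
  next
    case 4
    show False
      by (rule sorted[OF assms(4) 4 assms(10,11,9)])
  next
    case 5
    show False
      by (rule sorted[OF assms(5) 5 assms(11,9,10)])
  next
    case 6
    show False
      by (rule sorted[OF assms(5) 6 assms(11,10,9)])
  qed
qed

text \<open>A 4123 would need three distinct smaller values, and only \<open>u\<close> and
  \<open>v\<close> are available; the second premise excludes 321. The choice \<open>u = v\<close>
  covers positions with at most one smaller value to the right.\<close>

lemma avoids_at_few_smaller:
  assumes "\<And>j. i < j \<Longrightarrow> \<pi> j < \<pi> i \<Longrightarrow> \<pi> j = u \<or> \<pi> j = v"
    and "\<And>j k. i < j \<Longrightarrow> j < k \<Longrightarrow> \<pi> j < \<pi> i \<Longrightarrow> \<pi> k < \<pi> j \<Longrightarrow> False"
  shows "avoids_at \<pi> i"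
proof -
  have False if "i < j" "j < k" "k < l" "\<pi> j < \<pi> k" "\<pi> k < \<pi> l" "\<pi> l < \<pi> i" for j k l
    using assms(1)[of j] assms(1)[of k] assms(1)[of l] that by (auto simp: not_less_iff_gr_or_eq)
  then show ?thesis
    using assms(2) unfolding avoids_at_def by blast
qed

text \<open>Positions from \<open>a\<close> on carry values of \<open>\<rho>\<close> that are at
  least \<open>a\<close>, where the relabelling \<open>c\<close> is increasing.\<close>

lemma avoids_at_comp_strict_mono:
  assumes "\<rho> permutes {a..<b}" "strict_mono_on {a..} c" "a \<le> i"
  shows "avoids_at (c \<circ> \<rho>) i \<longleftrightarrow> avoids_at \<rho> i"
proof -
  have "a \<le> \<rho> j" if "a \<le> j" for j
    using assms(1) that permutes_in_image[OF assms(1), of j] permutes_not_in[OF assms(1), of j]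
    by (cases "j < b") auto
  then have "c (\<rho> j) < c (\<rho> k) \<longleftrightarrow> \<rho> j < \<rho> k" if "i \<le> j" "i \<le> k" for j k
    using that assms(2,3) strict_mono_on_less[OF assms(2)] by simp
  then show ?thesis
    by (simp add: avoids_at_def cong: conj_cong)
qed

section \<open>Cycle polynomials and prescribed initial values\<close>

definition orbit_poly :: "nat \<Rightarrow> nat \<Rightarrow> (nat \<Rightarrow> nat) \<Rightarrow> int poly" where
  "orbit_poly m b \<pi> = monom 1 (orbit_count {m..<b} \<pi>)"

text \<open>This is the cycle polynomial of length \<open>b - m\<close>. Indexing by the interval
  lets the removal of initial points raise \<open>m\<close> without renumbering the remaining
  positions.\<close>

definition class_poly :: "nat \<Rightarrow> nat \<Rightarrow> int poly" where
  "class_poly m b = sum (orbit_poly m b) (avoiding_perms m b)"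

text \<open>
  The permutations whose values on \<open>{m..<a}\<close> are prescribed by \<open>c\<close> arise from the permutations
  of \<open>{a..<b}\<close> by relabelling the values, here without changing the relative order at \<open>a\<close>
  and beyond.
\<close>

lemma sum_prescribed_prefix:
  assumes "m \<le> a" and c: "c permutes {m..<b}" "strict_mono_on {a..} c"
    and Q: "\<And>\<rho>. \<rho> \<in> avoiding_perms a b \<Longrightarrow> (\<forall>i\<in>{m..<a}. avoids_at (c \<circ> \<rho>) i) \<longleftrightarrow> Q \<rho>"
    and count: "\<And>\<rho>. \<rho> permutes {a..<b} \<Longrightarrow>
      orbit_count {m..<b} (c \<circ> \<rho>) = e + orbit_count {a..<b} \<rho>"
  shows "sum (orbit_poly m b) {\<pi> \<in> avoiding_perms m b. \<forall>i\<in>{m..<a}. \<pi> i = c i}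
    = monom 1 e * sum (orbit_poly a b) {\<rho> \<in> avoiding_perms a b. Q \<rho>}"
proof -
  let ?L = "{\<pi> \<in> avoiding_perms m b. \<forall>i\<in>{m..<a}. \<pi> i = c i}"
  let ?R = "{\<rho> \<in> avoiding_perms a b. Q \<rho>}"
  have sub: "{a..<b} \<subseteq> {m..<b}"
    using assms(1) by auto
  \<comment> \<open>Positions from \<open>a\<close> on behave as in \<open>\<rho>\<close>, positions
    below \<open>m\<close> are harmless, and \<open>Q\<close> describes the prefix.\<close>
  have avoid: "avoids_both (c \<circ> \<rho>) \<longleftrightarrow> \<rho> \<in> ?R" if \<rho>: "\<rho> permutes {a..<b}" for \<rho>
  proof -
    have perm: "c \<circ> \<rho> permutes {m..<b}"
      by (rule permutes_compose[OF permutes_subset[OF \<rho> sub] c(1)])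
    have "avoids_both (c \<circ> \<rho>) \<longleftrightarrow>
        (\<forall>i\<ge>a. avoids_at (c \<circ> \<rho>) i) \<and> (\<forall>i\<in>{m..<a}. avoids_at (c \<circ> \<rho>) i)"
      unfolding avoids_both_def using avoids_at_below[OF perm] by (metis atLeastLessThan_iff not_le)
    also have "(\<forall>i\<ge>a. avoids_at (c \<circ> \<rho>) i) \<longleftrightarrow> avoids_both \<rho>"
      unfolding avoids_both_def using avoids_at_comp_strict_mono[OF \<rho> c(2)] avoids_at_below[OF \<rho>] by (metis not_le)
    finally show ?thesis
      using Q[of \<rho>] \<rho> unfolding avoiding_perms_def mem_Collect_eq by blast
  qed
  have "bij_betw (\<lambda>\<rho>. c \<circ> \<rho>) ?R ?L"
  proof (rule bij_betw_byWitness[where f' = "\<lambda>\<pi>. inv c \<circ> \<pi>"])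
    show "\<forall>\<rho>\<in>?R. inv c \<circ> (c \<circ> \<rho>) = \<rho>" "\<forall>\<pi>\<in>?L. c \<circ> (inv c \<circ> \<pi>) = \<pi>"
      by (simp_all add: fun_eq_iff permutes_inverses[OF c(1)])
    show "(\<lambda>\<rho>. c \<circ> \<rho>) ` ?R \<subseteq> ?L"
    proof (intro image_subsetI)
      fix \<rho> assume R: "\<rho> \<in> ?R"
      then have \<rho>: "\<rho> permutes {a..<b}"
        by (simp add: avoiding_perms_def)
      have "c \<circ> \<rho> permutes {m..<b}"
        by (rule permutes_compose[OF permutes_subset[OF \<rho> sub] c(1)])
      then show "c \<circ> \<rho> \<in> ?L"
        using R avoid[OF \<rho>] permutes_not_in[OF \<rho>] by (simp add: avoiding_perms_def)
    qed
    show "(\<lambda>\<pi>. inv c \<circ> \<pi>) ` ?L \<subseteq> ?R"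
    proof (intro image_subsetI)
      fix \<pi> assume L: "\<pi> \<in> ?L"
      have "inv c \<circ> \<pi> permutes {m..<b}"
        using L permutes_compose[OF _ permutes_inv[OF c(1)]] by (simp add: avoiding_perms_def)
      \<comment> \<open>On the prefix \<open>\<pi>\<close> agrees with \<open>c\<close>, so
        \<open>inv c\<close> turns these positions into fixed points.\<close>
      moreover have "(inv c \<circ> \<pi>) i = i" if "i \<in> {m..<b} - {a..<b}" for i
      proof -
        have "i \<in> {m..<a}"
          using that by auto
        then show ?thesis
          using L permutes_inverses(2)[OF c(1)] by simp
      qed
      ultimately have \<rho>: "inv c \<circ> \<pi> permutes {a..<b}"
        by (rule permutes_superset)
      have "c \<circ> (inv c \<circ> \<pi>) = \<pi>"
        by (simp add: fun_eq_iff permutes_inverses[OF c(1)])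
      then show "inv c \<circ> \<pi> \<in> ?R"
        using L avoid[OF \<rho>] by (simp add: avoiding_perms_def)
    qed
  qed
  then have "sum (orbit_poly m b) ?L = (\<Sum>\<rho>\<in>?R. orbit_poly m b (c \<circ> \<rho>))"
    by (rule sum.reindex_bij_betw [symmetric])
  also have "\<dots> = (\<Sum>\<rho>\<in>?R. monom 1 e * orbit_poly a b \<rho>)"
    by (intro sum.cong refl) (simp add: orbit_poly_def avoiding_perms_def count mult_monom)
  finally show ?thesis
    by (simp add: sum_distrib_left)
qed

section \<open>The recurrence for the cycle polynomials\<close>

lemma interval_insert: "m < b \<Longrightarrow> {m..<b} = insert m {m + 1..<b}" for m b :: nat
  by auto

lemma permutes_interval_ge:
  fixes \<pi> :: "nat \<Rightarrow> nat"
  assumes "\<pi> permutes {m..<b}" "m \<le> j"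
  shows "m \<le> \<pi> j"
  using permutes_in_image[OF assms(1), of j] permutes_not_in[OF assms(1), of j] assms(2)
  by (cases "j < b") auto

lemma permutes_interval_preimage:
  fixes \<pi> :: "nat \<Rightarrow> nat"
  assumes "\<pi> permutes {m..<b}" "m \<le> v"
  obtains p where "\<pi> p = v" "m \<le> p"
  using permutes_interval_ge[OF permutes_inv[OF assms(1)] assms(2)] permutes_inverses(1)[OF assms(1)]
  by blast

lemma orbit_count_contract:
  fixes \<sigma> :: "nat \<Rightarrow> nat"
  assumes "\<sigma> permutes {m + 1..<b}" "m < k" "k < b"
  shows "orbit_count {m..<b} (transpose m k \<circ> \<sigma>) = orbit_count {m + 1..<b} \<sigma>"
proof -
  have "{m..<b} = insert m {m + 1..<b}"
    using assms by (intro interval_insert) simp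
  then show ?thesis
    using assms by (simp only:) (rule orbit_count_transpose_comp, auto)
qed

text \<open>The inner composite \<open>transpose (m + 1) l \<circ> \<rho>\<close> fixes
  \<open>m\<close>, so \<open>m\<close> can be contracted first and \<open>m + 1\<close>
  afterwards.\<close>

lemma orbit_count_contract_twice:
  fixes \<rho> :: "nat \<Rightarrow> nat"
  assumes "\<rho> permutes {m + 2..<b}" "m < k" "k < b" "m + 1 < l" "l < b"
  shows "orbit_count {m..<b} ((transpose m k \<circ> transpose (m + 1) l) \<circ> \<rho>)
    = orbit_count {m + 2..<b} \<rho>"
proof -
  have "{m + 2..<b} \<subseteq> {m + 1..<b}"
    by auto
  then have \<sigma>: "transpose (m + 1) l \<circ> \<rho> permutes {m + 1..<b}"
    using assms by (intro permutes_compose[OF permutes_subset[OF assms(1)]] permutes_swap_id) auto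
  have "orbit_count {m..<b} (transpose m k \<circ> (transpose (m + 1) l \<circ> \<rho>))
      = orbit_count {m + 1..<b} (transpose (m + 1) l \<circ> \<rho>)"
    using \<sigma> assms(2,3) by (rule orbit_count_contract)
  also have "\<dots> = orbit_count {m + 1 + 1..<b} \<rho>"
    using assms by (intro orbit_count_contract) simp_all
  finally show ?thesis
    by (simp add: o_assoc)
qed

section \<open>Contributions of the four possible beginnings\<close>

text \<open>An initial fixed point starts no occurrence and is a cycle of its own, which gives the
  factor \<open>monom 1 1\<close>.\<close>

lemma sum_first_fixed:
  assumes "m < b"
  shows "sum (orbit_poly m b) {\<pi> \<in> avoiding_perms m b. \<pi> m = m}
    = monom 1 1 * class_poly (m + 1) b"
proof -
  have "sum (orbit_poly m b) {\<pi> \<in> avoiding_perms m b. \<forall>i\<in>{m..<m + 1}. \<pi> i = id i}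
    = monom 1 1 * sum (orbit_poly (m + 1) b) {\<rho> \<in> avoiding_perms (m + 1) b. True}"
  proof (rule sum_prescribed_prefix)
    show "(\<forall>i\<in>{m..<m + 1}. avoids_at (id \<circ> \<rho>) i) \<longleftrightarrow> True"
      if "\<rho> \<in> avoiding_perms (m + 1) b" for \<rho>
      using that by (auto simp: avoiding_perms_def intro: avoids_at_below)
    show "orbit_count {m..<b} (id \<circ> \<rho>) = 1 + orbit_count {m + 1..<b} \<rho>"
      if "\<rho> permutes {m + 1..<b}" for \<rho>
      using that orbit_count_insert_fixpoint[OF _ that, of m] interval_insert[OF assms] by simp
    show "id permutes {m..<b}"
      by (rule permutes_id)
  qed (simp_all add: strict_mono_on_def)
  then show ?thesis
    by (simp add: class_poly_def)
qed

text \<open>Only the value \<open>m\<close> is smaller than the first entry, so no occurrence starts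
  there. Contracting \<open>m\<close> keeps the number of cycles.\<close>

lemma sum_first_second:
  assumes "m + 1 < b"
  shows "sum (orbit_poly m b) {\<pi> \<in> avoiding_perms m b. \<pi> m = m + 1} = class_poly (m + 1) b"
proof -
  let ?c = "transpose m (m + 1)"
  have c: "?c permutes {m..<b}"
    using assms by (intro permutes_swap_id) auto
  have "sum (orbit_poly m b) {\<pi> \<in> avoiding_perms m b. \<forall>i\<in>{m..<m + 1}. \<pi> i = ?c i}
    = monom 1 0 * sum (orbit_poly (m + 1) b) {\<rho> \<in> avoiding_perms (m + 1) b. True}"
  proof (rule sum_prescribed_prefix)
    show "(\<forall>i\<in>{m..<m + 1}. avoids_at (?c \<circ> \<rho>) i) \<longleftrightarrow> True"
      if "\<rho> \<in> avoiding_perms (m + 1) b" for \<rho>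
    proof -
      have \<rho>: "\<rho> permutes {m + 1..<b}"
        using that by (simp add: avoiding_perms_def)
      have "{m + 1..<b} \<subseteq> {m..<b}"
        by auto
      note perm = permutes_compose[OF permutes_subset[OF \<rho> this] c]
      have first: "(?c \<circ> \<rho>) m = m + 1"
        using permutes_not_in[OF \<rho>, of m] by simp
      have ge: "m \<le> (?c \<circ> \<rho>) j" if "m < j" for j
        using permutes_interval_ge[OF perm] that by simp
      have "avoids_at (?c \<circ> \<rho>) m"
      proof (rule avoids_at_few_smaller)
        show "(?c \<circ> \<rho>) j = m \<or> (?c \<circ> \<rho>) j = m"
          if "m < j" "(?c \<circ> \<rho>) j < (?c \<circ> \<rho>) m" for j
          using that ge[of j] unfolding first by linarith
        show False if "m < j" "j < k" "(?c \<circ> \<rho>) j < (?c \<circ> \<rho>) m"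
          "(?c \<circ> \<rho>) k < (?c \<circ> \<rho>) j" for j k
          using that ge[of k] unfolding first by linarith
      qed
      then show ?thesis
        by simp
    qed
    show "orbit_count {m..<b} (?c \<circ> \<rho>) = 0 + orbit_count {m + 1..<b} \<rho>"
      if "\<rho> permutes {m + 1..<b}" for \<rho>
      using orbit_count_contract[OF that, of "m + 1"] assms by simp
    \<comment> \<open>From \<open>m + 1\<close> on, \<open>?c\<close> only lowers
      \<open>m + 1\<close> to \<open>m\<close>.\<close>
    show "strict_mono_on {m + 1..} ?c"
      by (auto simp: strict_mono_on_def transpose_def)
    show "?c permutes {m..<b}"
      by (rule c)
  qed simp
  then show ?thesis
    by (simp add: class_poly_def monom_0)
qed

text \<open>The two values below the first entry are automatically in increasing order, since the
  smaller one comes immediately after it. The second entry is the minimum, so neither position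
  restricts the rest.\<close>

lemma sum_first_third_then_first:
  assumes "m + 2 < b"
  shows "sum (orbit_poly m b) {\<pi> \<in> avoiding_perms m b. \<pi> m = m + 2 \<and> \<pi> (m + 1) = m}
    = class_poly (m + 2) b"
proof -
  \<comment> \<open>This product prescribes the prefix 3 1, lowers \<open>m + 2\<close> to
    \<open>m + 1\<close> and fixes all larger values, so it is increasing from \<open>m + 2\<close>
    on.\<close>
  let ?c = "transpose m (m + 2) \<circ> transpose (m + 1) (m + 2)"
  have c: "?c permutes {m..<b}"
    using assms by (intro permutes_compose permutes_swap_id) auto
  have c_vals: "?c m = m + 2" "?c (m + 1) = m"
    by (auto simp: transpose_def)
  have ivl: "{m..<m + 2} = {m, m + 1}"
    by auto
  have "sum (orbit_poly m b) {\<pi> \<in> avoiding_perms m b. \<forall>i\<in>{m..<m + 2}. \<pi> i = ?c i}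
    = monom 1 0 * sum (orbit_poly (m + 2) b) {\<rho> \<in> avoiding_perms (m + 2) b. True}"
  proof (rule sum_prescribed_prefix)
    show "(\<forall>i\<in>{m..<m + 2}. avoids_at (?c \<circ> \<rho>) i) \<longleftrightarrow> True"
      if "\<rho> \<in> avoiding_perms (m + 2) b" for \<rho>
    proof -
      have \<rho>: "\<rho> permutes {m + 2..<b}"
        using that by (simp add: avoiding_perms_def)
      have sub: "{m + 2..<b} \<subseteq> {m..<b}"
        by auto
      define \<pi> where "\<pi> = ?c \<circ> \<rho>"
      have perm: "\<pi> permutes {m..<b}"
        unfolding \<pi>_def by (rule permutes_compose[OF permutes_subset[OF \<rho> sub] c])
      have vals: "\<pi> m = m + 2" "\<pi> (m + 1) = m"
        using permutes_not_in[OF \<rho>, of m] permutes_not_in[OF \<rho>, of "m + 1"] c_vals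
        by (simp_all add: \<pi>_def)
      have ge: "m \<le> \<pi> j" if "m < j" for j
        using permutes_interval_ge[OF perm] that by simp
      have "avoids_at \<pi> m"
      proof (rule avoids_at_few_smaller)
        show "\<pi> j = m \<or> \<pi> j = m + 1" if "m < j" "\<pi> j < \<pi> m" for j
          using that ge[of j] vals by auto
        show False if "m < j" "j < k" "\<pi> j < \<pi> m" "\<pi> k < \<pi> j" for j k
        proof -
          have "\<pi> k = \<pi> (m + 1)"
            using that ge[of j] ge[of k] vals by auto
          then have "k = m + 1"
            using permutes_inj[OF perm] by (simp add: inj_eq)
          then show False
            using that by simp
        qed
      qed
      moreover have "avoids_at \<pi> (m + 1)"
      proof (rule avoids_at_few_smaller)
        show "\<pi> j = m \<or> \<pi> j = m" if "m + 1 < j" "\<pi> j < \<pi> (m + 1)" for j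
          using that ge[of j] vals by auto
        show False if "m + 1 < j" "j < k" "\<pi> j < \<pi> (m + 1)" "\<pi> k < \<pi> j" for j k
          using that ge[of j] vals by auto
      qed
      ultimately show ?thesis
        unfolding \<pi>_def ivl by blast
    qed
    show "orbit_count {m..<b} (?c \<circ> \<rho>) = 0 + orbit_count {m + 2..<b} \<rho>"
      if "\<rho> permutes {m + 2..<b}" for \<rho>
      using orbit_count_contract_twice[OF that, of "m + 2" "m + 2"] assms by simp
    show "strict_mono_on {m + 2..} ?c"
      by (auto simp: strict_mono_on_def transpose_def)
    show "?c permutes {m..<b}"
      by (rule c)
  qed simp
  then show ?thesis
    unfolding ivl using c_vals by (simp add: class_poly_def monom_0)
qed

text \<open>After 3 4 the values 1 and 2 must appear in this order. They come from the two smallest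
  values of \<open>\<rho>\<close>, and as \<open>\<rho>\<close> avoids 321, these are reversed only
  if the second smallest comes first. Those \<open>\<rho>\<close> are counted by
  \<open>sum_first_second\<close> and subtracted.\<close>

lemma sum_first_third_then_fourth:
  assumes "m + 3 < b"
  shows "sum (orbit_poly m b) {\<pi> \<in> avoiding_perms m b. \<pi> m = m + 2 \<and> \<pi> (m + 1) = m + 3}
    = class_poly (m + 2) b - class_poly (m + 3) b"
proof -
  let ?c = "transpose m (m + 2) \<circ> transpose (m + 1) (m + 3)"
  let ?A = "avoiding_perms (m + 2) b"
  have c: "?c permutes {m..<b}"
    using assms by (intro permutes_compose permutes_swap_id) auto
  have c_vals: "?c m = m + 2" "?c (m + 1) = m + 3" "?c (m + 2) = m" "?c (m + 3) = m + 1"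
    by (auto simp: transpose_def)
  have ivl: "{m..<m + 2} = {m, m + 1}"
    by auto
  have "sum (orbit_poly m b) {\<pi> \<in> avoiding_perms m b. \<forall>i\<in>{m..<m + 2}. \<pi> i = ?c i}
    = monom 1 0 * sum (orbit_poly (m + 2) b) {\<rho> \<in> ?A. \<rho> (m + 2) \<noteq> m + 3}"
  proof (rule sum_prescribed_prefix)
    show "(\<forall>i\<in>{m..<m + 2}. avoids_at (?c \<circ> \<rho>) i) \<longleftrightarrow> \<rho> (m + 2) \<noteq> m + 3" if "\<rho> \<in> ?A" for \<rho>
    proof -
      have \<rho>: "\<rho> permutes {m + 2..<b}" and \<rho>_av: "avoids_at \<rho> (m + 2)"
        using that by (simp_all add: avoiding_perms_def avoids_both_def)
      have sub: "{m + 2..<b} \<subseteq> {m..<b}"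
        by auto
      define \<pi> where "\<pi> = ?c \<circ> \<rho>"
      have perm: "\<pi> permutes {m..<b}"
        unfolding \<pi>_def by (rule permutes_compose[OF permutes_subset[OF \<rho> sub] c])
      have vals: "\<pi> m = m + 2" "\<pi> (m + 1) = m + 3"
        using permutes_not_in[OF \<rho>, of m] permutes_not_in[OF \<rho>, of "m + 1"] c_vals
        by (simp_all add: \<pi>_def)
      have ge: "m \<le> \<pi> j" if "m < j" for j
        using permutes_interval_ge[OF perm] that by simp
      have inj: "\<pi> x = \<pi> y \<longleftrightarrow> x = y" for x y
        using permutes_inj[OF perm] by (simp add: inj_eq)
      obtain p where p: "\<rho> p = m + 2" "m + 2 \<le> p"
        using permutes_interval_preimage[OF \<rho>, of "m + 2"] by auto
      obtain q where q: "\<rho> q = m + 3" "m + 2 \<le> q"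
        using permutes_interval_preimage[OF \<rho>, of "m + 3"] by auto
      have \<pi>pq: "\<pi> p = m" "\<pi> q = m + 1"
        using p q c_vals by (simp_all add: \<pi>_def)
      \<comment> \<open>If \<open>m + 3\<close> preceded \<open>m + 2\<close> without being first in
        \<open>\<rho>\<close>, the first entry would exceed both and complete a 321.\<close>
      have pq: "p < q" if "\<rho> (m + 2) \<noteq> m + 3"
      proof (rule ccontr)
        assume "\<not> p < q"
        then have "q < p"
          using p q by (cases p q rule: linorder_cases) auto
        moreover have "m + 2 < q"
          using q that by (cases "q = m + 2") auto
        moreover have "m + 3 < \<rho> (m + 2)"
        proof -
          have "\<rho> (m + 2) \<noteq> m + 2"
            using p(1) \<open>q < p\<close> q(2) permutes_inj[OF \<rho>] by (metis inj_eq leD)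
          then show ?thesis
            using that permutes_interval_ge[OF \<rho>, of "m + 2"] by simp
        qed
        ultimately show False
          using \<rho>_av p q unfolding avoids_at_def by auto
      qed
      have "\<rho> (m + 2) \<noteq> m + 3" if "avoids_at \<pi> m"
      proof
        assume "\<rho> (m + 2) = m + 3"
        then have "q = m + 2"
          using q(1) permutes_inj[OF \<rho>] by (metis inj_eq)
        then have "q < p"
          using p q by (cases "p = q") auto
        then have "m < q \<and> q < p \<and> \<pi> p < \<pi> q \<and> \<pi> q < \<pi> m"
          using q(2) \<pi>pq vals by simp
        then show False
          using that unfolding avoids_at_def by blast
      qed
      moreover have "avoids_at \<pi> i" if i: "i = m \<or> i = m + 1" and 1: "\<rho> (m + 2) \<noteq> m + 3" for i
      proof -
        \<comment> \<open>For \<open>i = m + 1\<close> the value \<open>m + 2\<close> is also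
          smaller, but it stands to the left.\<close>
        have small: "\<pi> j = m \<or> \<pi> j = m + 1" if "i < j" "\<pi> j < \<pi> i" for j
        proof -
          have "\<pi> j \<noteq> \<pi> m"
            using that i unfolding inj by auto
          then show ?thesis
            using that i ge[of j] vals by auto
        qed
        show ?thesis
        proof (rule avoids_at_few_smaller)
          show False if "i < j" "j < k" "\<pi> j < \<pi> i" "\<pi> k < \<pi> j" for j k
          proof -
            have "\<pi> j = \<pi> q" "\<pi> k = \<pi> p"
              using small[of j] ge[of k] \<pi>pq that i by auto
            then show False
              using pq[OF 1] \<open>j < k\<close> unfolding inj by simp
          qed
        qed (rule small)
      qed
      ultimately show ?thesis
        unfolding ivl \<pi>_def by blast
    qed
    show "orbit_count {m..<b} (?c \<circ> \<rho>) = 0 + orbit_count {m + 2..<b} \<rho>"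
      if "\<rho> permutes {m + 2..<b}" for \<rho>
      using orbit_count_contract_twice[OF that, of "m + 2" "m + 3"] assms by simp
    show "strict_mono_on {m + 2..} ?c"
      by (auto simp: strict_mono_on_def transpose_def)
    show "?c permutes {m..<b}"
      by (rule c)
  qed simp
  moreover have "sum (orbit_poly (m + 2) b) {\<rho> \<in> ?A. \<rho> (m + 2) \<noteq> m + 3}
      = class_poly (m + 2) b - sum (orbit_poly (m + 2) b) {\<rho> \<in> ?A. \<rho> (m + 2) = m + 3}"
  proof -
    have "?A = {\<rho> \<in> ?A. \<rho> (m + 2) \<noteq> m + 3} \<union> {\<rho> \<in> ?A. \<rho> (m + 2) = m + 3}"
      by blast
    then have "class_poly (m + 2) b = sum (orbit_poly (m + 2) b) {\<rho> \<in> ?A. \<rho> (m + 2) \<noteq> m + 3}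
        + sum (orbit_poly (m + 2) b) {\<rho> \<in> ?A. \<rho> (m + 2) = m + 3}"
      unfolding class_poly_def
      by (subst sum.union_disjoint[symmetric]) (auto simp: finite_avoiding_perms)
    then show ?thesis
      by simp
  qed
  moreover have "sum (orbit_poly (m + 2) b) {\<rho> \<in> ?A. \<rho> (m + 2) = m + 3} = class_poly (m + 3) b"
    using sum_first_second[of "m + 2" b] assms by (simp add: numeral_eq_Suc)
  ultimately show ?thesis
    unfolding ivl using c_vals by (simp add: monom_0)
qed

text \<open>A first entry above \<open>m + 2\<close> has \<open>m\<close>, \<open>m + 1\<close>,
  \<open>m + 2\<close> to its right. After a first entry \<open>m + 2\<close>, a second entry
  \<open>m + 1\<close> gives 321 with the later \<open>m\<close>, and one above \<open>m + 3\<close>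
  has \<open>m\<close>, \<open>m + 1\<close>, \<open>m + 3\<close> to its right.\<close>

lemma avoiding_perms_first_values:
  assumes "\<pi> \<in> avoiding_perms m b" "m < b"
  shows "\<pi> m = m \<or> \<pi> m = m + 1 \<and> m + 1 < b \<or>
    \<pi> m = m + 2 \<and> \<pi> (m + 1) = m \<and> m + 2 < b \<or>
    \<pi> m = m + 2 \<and> \<pi> (m + 1) = m + 3 \<and> m + 3 < b"
proof -
  have perm: "\<pi> permutes {m..<b}" and av: "avoids_at \<pi> i" for i
    using assms(1) by (auto simp: avoiding_perms_def avoids_both_def)
  have inj: "inj \<pi>"
    by (rule permutes_inj[OF perm])
  have first_bounds: "m \<le> \<pi> m" "\<pi> m < b"
    using permutes_in_image[OF perm, of m] assms(2) by auto
  \<comment> \<open>These are the positions of the values \<open>m\<close> to \<open>m + 3\<close>;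
    a value not below \<open>b\<close> is a fixed point outside the interval.\<close>
  obtain p where p: "\<pi> p = m" "m \<le> p"
    using permutes_interval_preimage[OF perm, of m] by auto
  obtain q where q: "\<pi> q = m + 1" "m \<le> q"
    using permutes_interval_preimage[OF perm, of "m + 1"] by auto
  obtain r where r: "\<pi> r = m + 2" "m \<le> r"
    using permutes_interval_preimage[OF perm, of "m + 2"] by auto
  obtain s where s: "\<pi> s = m + 3" "m \<le> s"
    using permutes_interval_preimage[OF perm, of "m + 3"] by auto
  have first: "\<pi> m \<le> m + 2"
  proof (rule ccontr)
    assume big: "\<not> \<pi> m \<le> m + 2"
    then have "m \<noteq> p" "m \<noteq> q" "m \<noteq> r" "p \<noteq> q" "p \<noteq> r" "q \<noteq> r"
      using p q r by auto
    then show False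
      using big p q r by (intro avoids_at_three_smaller[OF av inj, of m p q r]) auto
  qed
  have "\<pi> (m + 1) = m \<and> m + 2 < b \<or> \<pi> (m + 1) = m + 3 \<and> m + 3 < b" if third: "\<pi> m = m + 2"
  proof -
    have second_bounds: "m \<le> \<pi> (m + 1)" "\<pi> (m + 1) < b"
      using permutes_in_image[OF perm, of "m + 1"] first_bounds third by auto
    have "\<pi> (m + 1) \<noteq> m + 2"
      using third inj_eq[OF inj, of m "m + 1"] by simp
    moreover have "\<pi> (m + 1) \<noteq> m + 1"
    proof
      assume eq: "\<pi> (m + 1) = m + 1"
      then have "p \<noteq> m" "p \<noteq> m + 1"
        using p third by auto
      then have "m + 1 < p"
        using p(2) by simp
      then have "m < m + 1 \<and> m + 1 < p \<and> \<pi> p < \<pi> (m + 1) \<and> \<pi> (m + 1) < \<pi> m"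
        using p(1) third eq by simp
      then show False
        using av[of m] unfolding avoids_at_def by blast
    qed
    moreover have "\<pi> (m + 1) \<le> m + 3"
    proof (rule ccontr)
      assume big: "\<not> \<pi> (m + 1) \<le> m + 3"
      have "m + 1 < x" if "m \<le> x" "\<pi> x \<in> {m, m + 1, m + 3}" for x
      proof -
        have "x \<noteq> m" "x \<noteq> m + 1"
          using that(2) big third by auto
        then show ?thesis
          using that(1) by simp
      qed
      then have "m + 1 < p" "m + 1 < q" "m + 1 < s"
        using p q s by blast+
      moreover have "p \<noteq> q" "p \<noteq> s" "q \<noteq> s"
        using p q s by auto
      ultimately show False
        using big p q s by (intro avoids_at_three_smaller[OF av inj, of "m + 1" p q s]) auto
    qed
    ultimately show ?thesis
      using second_bounds first_bounds third by auto
  qed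
  then show ?thesis
    using first first_bounds by auto
qed

text \<open>The four beginnings are mutually exclusive. The guards remove those whose values do not
  fit into a short interval.\<close>

lemma class_poly_unfold:
  assumes "m < b"
  shows "class_poly m b = monom 1 1 * class_poly (m + 1) b
    + (if m + 1 < b then class_poly (m + 1) b else 0)
    + (if m + 2 < b then class_poly (m + 2) b else 0)
    + (if m + 3 < b then class_poly (m + 2) b - class_poly (m + 3) b else 0)"
proof -
  let ?A = "avoiding_perms m b"
  define S1 where "S1 = {\<pi> \<in> ?A. \<pi> m = m}"
  define S2 where "S2 = (if m + 1 < b then {\<pi> \<in> ?A. \<pi> m = m + 1} else {})"
  define S3 where "S3 = (if m + 2 < b then {\<pi> \<in> ?A. \<pi> m = m + 2 \<and> \<pi> (m + 1) = m} else {})"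
  define S4 where "S4 = (if m + 3 < b then {\<pi> \<in> ?A. \<pi> m = m + 2 \<and> \<pi> (m + 1) = m + 3} else {})"
  note S_defs = S1_def S2_def S3_def S4_def
  have "?A = S1 \<union> S2 \<union> S3 \<union> S4"
  proof (intro equalityI subsetI)
    show "\<pi> \<in> S1 \<union> S2 \<union> S3 \<union> S4" if "\<pi> \<in> ?A" for \<pi>
      using avoiding_perms_first_values[OF that assms] that by (elim disjE) (simp_all add: S_defs)
  qed (auto simp: S_defs split: if_splits)
  moreover have "finite S1" "finite S2" "finite S3" "finite S4"
    by (simp_all add: S_defs finite_avoiding_perms)
  moreover have "S1 \<inter> S2 = {}" "(S1 \<union> S2) \<inter> S3 = {}" "(S1 \<union> S2 \<union> S3) \<inter> S4 = {}"
    by (auto simp: S_defs)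
  ultimately have "class_poly m b = sum (orbit_poly m b) S1 + sum (orbit_poly m b) S2
      + sum (orbit_poly m b) S3 + sum (orbit_poly m b) S4"
    by (simp add: class_poly_def sum.union_disjoint)
  moreover have "sum (orbit_poly m b) S1 = monom 1 1 * class_poly (m + 1) b"
    using sum_first_fixed[OF assms] by (simp add: S1_def)
  moreover have "sum (orbit_poly m b) S2 = (if m + 1 < b then class_poly (m + 1) b else 0)"
    using sum_first_second[of m b] by (simp add: S2_def)
  moreover have "sum (orbit_poly m b) S3 = (if m + 2 < b then class_poly (m + 2) b else 0)"
    using sum_first_third_then_first[of m b] by (simp add: S3_def)
  moreover have "sum (orbit_poly m b) S4
      = (if m + 3 < b then class_poly (m + 2) b - class_poly (m + 3) b else 0)"
    using sum_first_third_then_fourth[of m b] by (simp add: S4_def)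
  ultimately show ?thesis
    by simp
qed

section \<open>The recurrence in terms of the length\<close>

lemma class_poly_empty: "class_poly m m = 1"
proof -
  have "avoids_both id"
    by (auto simp: avoids_both_def avoids_at_def)
  then have "avoiding_perms m m = {id}"
    by (auto simp: avoiding_perms_def)
  then show ?thesis
    by (simp add: class_poly_def orbit_poly_def orbit_count_def monom_0)
qed

text \<open>Both sides unfold by the same recurrence, so induction on the length replaces a
  conjugation by a translation.\<close>

lemma class_poly_shift: "class_poly m (m + k) = class_poly 0 k"
proof (induction k arbitrary: m rule: less_induct)
  case (less k)
  show ?case
  proof (cases "k = 0")
    case True
    then show ?thesis
      by (simp add: class_poly_empty)
  next
    case False
    have *: "class_poly (m + i) (m + k) = class_poly i k" if "0 < i" "i \<le> k" for m i
      using less.IH[of "k - i" "m + i"] less.IH[of "k - i" i] that by simp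
    show ?thesis
      using False *[of 1 m] *[of 2 m] *[of 3 m]
      by (subst (1 2) class_poly_unfold) simp_all
  qed
qed

lemma class_poly_step:
  "class_poly 0 (Suc k) = monom 1 1 * class_poly 0 k
    + (if 1 \<le> k then class_poly 0 k else 0)
    + (if 2 \<le> k then class_poly 0 (k - 1) else 0)
    + (if 3 \<le> k then class_poly 0 (k - 1) - class_poly 0 (k - 2) else 0)"
proof -
  have "class_poly i (Suc k) = class_poly 0 (Suc k - i)" if "i \<le> Suc k" for i
    using class_poly_shift[of i "Suc k - i"] that by simp
  then show ?thesis
    by (subst class_poly_unfold) simp_all
qed

text \<open>All four beginnings fit only from length 4 on, so lengths 1 to 3 give separate initial
  values.\<close>

lemma class_poly_one: "class_poly 0 (Suc 0) = monom 1 1"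
  using class_poly_step[of 0] by (simp add: class_poly_empty)

lemma class_poly_two: "class_poly 0 2 = (monom 1 1 + 1) * class_poly 0 (Suc 0)"
  using class_poly_step[of 1] by (simp add: algebra_simps numeral_eq_Suc)

lemma class_poly_three: "class_poly 0 3 = (monom 1 1 + 1) * class_poly 0 2 + class_poly 0 (Suc 0)"
  using class_poly_step[of 2] by (simp add: algebra_simps numeral_eq_Suc)

lemma class_poly_rec:
  "class_poly 0 (k + 4) = (monom 1 1 + 1) * class_poly 0 (k + 3)
    + 2 * class_poly 0 (k + 2) - class_poly 0 (k + 1)"
  using class_poly_step[of "k + 3"] by (simp add: algebra_simps numeral_eq_Suc)

section \<open>The generating function\<close>

lemma contains_321_iff:
  "contains_pattern n \<pi> [3, 2, 1] \<longleftrightarrow>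
    (\<exists>i j k. 1 \<le> i \<and> i < j \<and> j < k \<and> k \<le> n \<and> \<pi> k < \<pi> j \<and> \<pi> j < \<pi> i)"
  (is "_ \<longleftrightarrow> ?R")
proof
  assume "contains_pattern n \<pi> [3, 2, 1]"
  then obtain xs where xs: "sorted_wrt (<) xs" "set xs \<subseteq> {1..n}"
    "same_relative_order (map \<pi> xs) [3, 2, 1]"
    unfolding contains_pattern_def by blast
  from xs(3) have "length xs = 3"
    by (simp add: same_relative_order_def)
  then obtain i j k where ijk: "xs = [i, j, k]"
    by (auto simp: numeral_eq_Suc length_Suc_conv)
  have "\<pi> k < \<pi> j \<and> \<pi> j < \<pi> i"
    using xs(3) unfolding ijk by (simp add: same_relative_order_def numeral_eq_Suc All_less_Suc)
  then show ?R
    using xs(1,2) unfolding ijk by auto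
next
  assume ?R
  then obtain i j k where "1 \<le> i" "i < j" "j < k" "k \<le> n" "\<pi> k < \<pi> j" "\<pi> j < \<pi> i"
    by blast
  then show "contains_pattern n \<pi> [3, 2, 1]"
    unfolding contains_pattern_def
    by (intro exI[of _ "[i, j, k]"])
      (auto simp: same_relative_order_def numeral_eq_Suc All_less_Suc)
qed

lemma contains_4123_iff:
  "contains_pattern n \<pi> [4, 1, 2, 3] \<longleftrightarrow>
    (\<exists>i j k l. 1 \<le> i \<and> i < j \<and> j < k \<and> k < l \<and> l \<le> n \<and>
      \<pi> j < \<pi> k \<and> \<pi> k < \<pi> l \<and> \<pi> l < \<pi> i)"
  (is "_ \<longleftrightarrow> ?R")
proof
  assume "contains_pattern n \<pi> [4, 1, 2, 3]"
  then obtain xs where xs: "sorted_wrt (<) xs" "set xs \<subseteq> {1..n}"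
    "same_relative_order (map \<pi> xs) [4, 1, 2, 3]"
    unfolding contains_pattern_def by blast
  from xs(3) have "length xs = 4"
    by (simp add: same_relative_order_def)
  then obtain i j k l where ijkl: "xs = [i, j, k, l]"
    by (auto simp: numeral_eq_Suc length_Suc_conv)
  have "\<pi> j < \<pi> k \<and> \<pi> k < \<pi> l \<and> \<pi> l < \<pi> i"
    using xs(3) unfolding ijkl by (simp add: same_relative_order_def numeral_eq_Suc All_less_Suc)
  then show ?R
    using xs(1,2) unfolding ijkl by auto
next
  assume ?R
  then obtain i j k l where "1 \<le> i" "i < j" "j < k" "k < l" "l \<le> n"
      "\<pi> j < \<pi> k" "\<pi> k < \<pi> l" "\<pi> l < \<pi> i"
    by blast
  then show "contains_pattern n \<pi> [4, 1, 2, 3]"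
    unfolding contains_pattern_def
    by (intro exI[of _ "[i, j, k, l]"])
      (auto simp: same_relative_order_def numeral_eq_Suc All_less_Suc)
qed

text \<open>The first and last positions of an occurrence form an inversion, so
  \<open>permutes_descent_bounds\<close> confines the occurrence to \<open>{1..n}\<close>.\<close>

lemma avoiders_eq: "avoiders n {[3, 2, 1], [4, 1, 2, 3]} = avoiding_perms 1 (1 + n)"
proof -
  have "(\<not> contains_pattern n \<pi> [3, 2, 1] \<and> \<not> contains_pattern n \<pi> [4, 1, 2, 3]) \<longleftrightarrow> avoids_both \<pi>"
    if "\<pi> permutes {1..<1 + n}" for \<pi>
  proof -
    have "1 \<le> i \<and> j \<le> n" if "i < j" "\<pi> j < \<pi> i" for i j
      using permutes_descent_bounds[OF \<open>\<pi> permutes _\<close> that] by simp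
    then show ?thesis
      unfolding contains_321_iff contains_4123_iff avoids_both_def avoids_at_def
      by (meson less_trans)
  qed
  then show ?thesis
    by (auto simp: avoiders_def avoiding_perms_def atLeastLessThanSuc_atLeastAtMost)
qed

lemma cycle_gf_nth:
  assumes "0 < n"
  shows "fps_nth (cycle_gf {[3, 2, 1], [4, 1, 2, 3]}) n = class_poly 0 n"
proof -
  let ?A = "avoiding_perms 1 (1 + n)"
  have cyc: "cyc n \<pi> = orbit_count {1..<1 + n} \<pi>" for \<pi>
    by (simp add: cyc_def orbit_count_def atLeastLessThanSuc_atLeastAtMost)
  \<comment> \<open>For positive \<open>n\<close> every cycle count lies in \<open>{1..n}\<close>,
    so grouping by \<open>k\<close> omits no permutation.\<close>
  have "0 < cyc n \<pi>" for \<pi>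
    using assms by (simp add: cyc_def card_gt_0_iff)
  then have range: "cyc n ` ?A \<subseteq> {1..n}"
    using cyc_le by (auto simp: Suc_le_eq)
  have "fps_nth (cycle_gf {[3, 2, 1], [4, 1, 2, 3]}) n
      = (\<Sum>k = 1..n. monom (int (card {\<pi> \<in> ?A. cyc n \<pi> = k})) k)"
    by (simp only: cycle_gf_def fps_nth_Abs_fps avoiders_eq)
  also have "\<dots> = (\<Sum>k = 1..n. \<Sum>\<pi> | \<pi> \<in> ?A \<and> cyc n \<pi> = k. monom 1 (cyc n \<pi>))"
    by (intro sum.cong refl) (simp add: of_nat_poly smult_monom of_nat_mult_conv_smult)
  also have "\<dots> = (\<Sum>\<pi>\<in>?A. monom 1 (cyc n \<pi>))"
    using range by (intro sum.group) (auto simp: finite_avoiding_perms)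
  also have "\<dots> = class_poly 1 (1 + n)"
    by (simp add: class_poly_def orbit_poly_def cyc)
  finally show ?thesis
    by (simp only: class_poly_shift)
qed

theorem theorem12:
  shows "(let t = fps_const (monom 1 1) :: int poly fps; z = fps_X in
    cycle_gf {[3, 2, 1], [4, 1, 2, 3]} =
      fps_quot (t * z * (1 - z ^ 2)) (1 - z * (1 + t) - 2 * z ^ 2 + z ^ 3))"
proof -
  let ?t = "fps_const (monom 1 1) :: int poly fps"
  let ?z = "fps_X :: int poly fps"
  define F where "F = cycle_gf {[3, 2, 1], [4, 1, 2, 3]}"
  let ?num = "?t * ?z * (1 - ?z ^ 2)"
  let ?den = "1 - ?z * (1 + ?t) - 2 * ?z ^ 2 + ?z ^ 3"
  \<comment> \<open>This differs from \<open>class_poly 0 0 = 1\<close>; the recurrence from length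
    4 on only reaches back to length 1.\<close>
  have F0: "fps_nth F 0 = 0"
    by (simp add: F_def cycle_gf_def)
  have F_nth: "fps_nth F n = class_poly 0 n" if "0 < n" for n
    unfolding F_def using that by (rule cycle_gf_nth)
  have F2_nth: "fps_nth (F * 2) n = fps_nth F n * 2" for n
    by (simp only: mult_2_right fps_add_nth)
  have "F * ?den = ?num"
  proof (rule fps_ext)
    fix n :: nat
    have den: "F * ?den = F - ?z * (F + ?t * F) - ?z ^ 2 * (F + F) + ?z ^ 3 * F"
      by (simp add: algebra_simps)
    have num: "?num = ?z * ?t - ?z ^ 3 * ?t"
      by (simp add: algebra_simps power2_eq_square power3_eq_cube)
    \<comment> \<open>The initial values produce the coefficients \<open>t\<close> at 1 and
      \<open>-t\<close> at 3 of the numerator; from 4 on the recurrence makes the coefficients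
      vanish.\<close>
    have "n = 0 \<or> n = 1 \<or> n = 2 \<or> n = 3 \<or> n = (n - 4) + 4"
      by linarith
    then consider "n = 0" | "n = 1" | "n = 2" | "n = 3" | k where "n = k + 4"
      by blast
    then show "fps_nth (F * ?den) n = fps_nth ?num n"
      unfolding num den
      by cases (simp_all add: fps_X_power_mult_nth F0 F_nth class_poly_one class_poly_two
          class_poly_three class_poly_rec, simp_all add: algebra_simps F2_nth F_nth)
  qed
  moreover have "fps_nth ?den 0 = 1"
    by simp
  then have "fps_quot ?num ?den * ?den = ?num"
    by (rule fps_quot_mult)
  moreover have "?den \<noteq> 0"
    using \<open>fps_nth ?den 0 = 1\<close> by (metis fps_zero_nth zero_neq_one)
  \<comment> \<open>Power series over \<open>int poly\<close> form an integral domain, so the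
    nonzero denominator cancels.\<close>
  ultimately have "F = fps_quot ?num ?den"
    by (metis mult_right_cancel)
  then show ?thesis
    by (simp add: Let_def F_def)
qed

end
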